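(* Let $X$ be a linearly repetitive Delone set in $\mathbb{R}^n$. Then there is a constant $\delta=\delta(X)>0$ such that every local weight distribution $\mathbf{w}$ on $X$ (with values in $\mathbb{R}^s$) has an average value $\mathbf{f}\in\mathbb{R}^s$ satisfying $$\frac{\mathbf{w}(B)}{\operatorname{vol}_n(B)}=\mathbf{f}+O(\omega(B)^{-\delta})$$ as $\omega(B)$ tends to infinity, where $B$ ranges over boxes in $\mathbb{R}^n$ and the $O$-constant may depend on $\mathbf{w}$ as well as $X$.
   Context: A Delone set in $\mathbb{R}^n$ is a set $X\subset\mathbb{R}^n$ for which there are $r,R>0$ such that each open ball of radius $r$ contains at most one point of $X$ and each closed ball of radius $R$ contains at least one point of $X$. $B(\mathbf{x};T)$ is the closed ball of radius $T$ centered at $\mathbf{x}$. $X$ is repetitive if for each $T>0$ there is a finite $M>0$ such that every closed ball of radius $M$ in $\mathbb{R}^n$ contains, for every $\mathbf{y}\in X$, some $\mathbf{x}\in X$ with $(X\cap B(\mathbf{x};T))-\mathbf{x}=(X\cap B(\mathbf{y};T))-\mathbf{y}$; $M_X(T)$ denotes the least such $M$. $X$ is linearly repetitive if it is repetitive and $M_X(T)=O(T)$ as $T\to\infty$. A box is a set $B=\prod_{i=1}^n[a_i,b_i]$ with $a_i<b_i$; with $l_i=b_i-a_i$, its volume is $\operatorname{vol}_n(B)=\prod l_i$, its surface area is $\sigma(B)=2\operatorname{vol}_n(B)\sum_{i=1}^n 1/l_i$ and its width is $\omega(B)=\min_i l_i$. A local weight distribution on $X$ is a function $\mathbf{w}$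 with values in $\mathbb{R}^s$ whose domain is the set of all boxes $B$ in $\mathbb{R}^n$ with $\omega(B)>U_0$ (for some $U_0\ge0$) such that, with $O$-constants depending only on $\mathbf{w}$ and for boxes in the domain: (a) $\mathbf{w}(B)=O(\operatorname{vol}_n(B))$; (b) if $(B+\mathbf{t})\cap X=(B\cap X)+\mathbf{t}$ for some $\mathbf{t}\in\mathbb{R}^n$, then $\mathbf{w}(B+\mathbf{t})=\mathbf{w}(B)+O(\sigma(B))$; (c) if $B=B_1\cup\cdots\cup B_k$ is a partition of $B$ into non-overlapping smaller boxes, then $\mathbf{w}(B)=\sum_{i=1}^k\mathbf{w}(B_i)+O\left(\sum_{i=1}^k\sigma(B_i)\right)$. *)

theory Defs
  imports "HOL-Analysis.Analysis" "HOL-Library.Landau_Symbols"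
begin

definition delone :: "(real ^ 'n) set \<Rightarrow> bool" where
  "delone X \<longleftrightarrow>
     (\<exists>r>0. \<exists>R>0. (\<forall>c. \<exists>\<^sub>\<le>\<^sub>1 x. x \<in> X \<inter> ball c r) \<and> (\<forall>c. X \<inter> cball c R \<noteq> {}))"

definition patch :: "(real ^ 'n) set \<Rightarrow> real ^ 'n \<Rightarrow> real \<Rightarrow> (real ^ 'n) set" where
  "patch X x T = (\<lambda>z. z - x) ` (X \<inter> cball x T)"

definition repetitivity_bound :: "(real ^ 'n) set \<Rightarrow> real \<Rightarrow> real \<Rightarrow> bool" where
  "repetitivity_bound X T M \<longleftrightarrow>
     M > 0 \<and> (\<forall>c. \<forall>y\<in>X. \<exists>x\<in>X. x \<in> cball c M \<and> patch X x T = patch X y T)"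

definition repetitive :: "(real ^ 'n) set \<Rightarrow> bool" where
  "repetitive X \<longleftrightarrow> (\<forall>T>0. \<exists>M. repetitivity_bound X T M)"

(* LEAST ranges over the reals here; for a repetitive Delone set the minimum is attained,
   see repetitivity_function_attained below. *)
definition repetitivity_function :: "(real ^ 'n) set \<Rightarrow> real \<Rightarrow> real" where
  "repetitivity_function X T = (LEAST M. repetitivity_bound X T M)"

definition linearly_repetitive :: "(real ^ 'n) set \<Rightarrow> bool" where
  "linearly_repetitive X \<longleftrightarrow> repetitive X \<and> repetitivity_function X \<in> O[at_top](\<lambda>T. T)"

definition is_box :: "(real ^ 'n) set \<Rightarrow> bool" where
  "is_box B \<longleftrightarrow> (\<exists>a b. (\<forall>i. a $ i < b $ i) \<and> B = cbox a b)"

definition side_length :: "(real ^ 'n) set \<Rightarrow> 'n \<Rightarrow> real" where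
  "side_length B i = interval_upperbound B $ i - interval_lowerbound B $ i"

definition box_volume :: "(real ^ 'n) set \<Rightarrow> real" where
  "box_volume B = (\<Prod>i\<in>UNIV. side_length B i)"

definition surface_area :: "(real ^ 'n) set \<Rightarrow> real" where
  "surface_area B = 2 * box_volume B * (\<Sum>i\<in>UNIV. 1 / side_length B i)"

definition box_width :: "(real ^ 'n) set \<Rightarrow> real" where
  "box_width B = Min (range (side_length B))"

definition boxes_wider_than :: "real \<Rightarrow> (real ^ 'n) set set" where
  "boxes_wider_than U = {B. is_box B \<and> box_width B > U}"

(* The target space R^s is the carrier of the library's Euclidean_space s, i.e. the functions
   nat => real that vanish from index s on, with the Euclidean norm L2_set over {..<s}. A type
   index for s is not usable: the theorem quantifies over s after choosing delta.
   The partial function w is modelled by a total one that is only constrained on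
   boxes_wider_than U0, its domain. *)
definition local_weight_distribution ::
    "(real ^ 'n) set \<Rightarrow> nat \<Rightarrow> real \<Rightarrow> ((real ^ 'n) set \<Rightarrow> nat \<Rightarrow> real) \<Rightarrow> bool" where
  "local_weight_distribution X s U0 w \<longleftrightarrow>
     U0 \<ge> 0 \<and>
     (\<forall>B \<in> boxes_wider_than U0. w B \<in> topspace (Euclidean_space s)) \<and>
     (\<exists>C. \<forall>B \<in> boxes_wider_than U0. L2_set (w B) {..<s} \<le> C * box_volume B) \<and>
     (\<exists>C. \<forall>B \<in> boxes_wider_than U0. \<forall>t.
        (+) t ` B \<inter> X = (+) t ` (B \<inter> X) \<longrightarrow>
        L2_set (\<lambda>j. w ((+) t ` B) j - w B j) {..<s} \<le> C * surface_area B) \<and>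
     (\<exists>C. \<forall>B \<in> boxes_wider_than U0. \<forall>P. P division_of B \<and> P \<subseteq> boxes_wider_than U0 \<longrightarrow>
        L2_set (\<lambda>j. w B j - (\<Sum>B'\<in>P. w B' j)) {..<s} \<le> C * (\<Sum>B'\<in>P. surface_area B'))"

definition width_to_infinity :: "(real ^ 'n) set filter" where
  "width_to_infinity = inf (filtercomap box_width at_top) (principal {B. is_box B})"

lemma eventually_width_to_infinity:
  "eventually P width_to_infinity \<longleftrightarrow> (\<exists>U. \<forall>B \<in> boxes_wider_than U. P B)"
  unfolding width_to_infinity_def eventually_inf_principal
    eventually_filtercomap_at_top_dense boxes_wider_than_def by auto

lemma side_length_cbox:
  assumes "\<forall>i. a $ i < b $ i"
  shows "side_length (cbox a b) i = b $ i - a $ i"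
proof -
  have "\<forall>k\<in>Basis. a \<bullet> k \<le> b \<bullet> k"
    using assms by (auto simp: Basis_vec_def inner_axis less_imp_le)
  then show ?thesis by (simp add: side_length_def)
qed

lemma delone_finite_cball:
  assumes "delone X"
  shows "finite (X \<inter> cball c d)"
proof -
  from assms obtain r where r: "r > 0" "\<And>c. \<exists>\<^sub>\<le>\<^sub>1 x. x \<in> X \<inter> ball c r"
    unfolding delone_def by blast
  obtain K where K: "finite K" "cball c d \<subseteq> (\<Union>x\<in>K. ball x r)"
    using compact_cball[of c d] r(1) unfolding compact_eq_totally_bounded by blast
  have "finite (X \<inter> ball x r)" for x
  proof (cases "X \<inter> ball x r = {}")
    case False
    then obtain u where "u \<in> X \<inter> ball x r" by blast
    with r(2)[of x] have "X \<inter> ball x r \<subseteq> {u}" by (auto simp: Uniq_def)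
    then show ?thesis by (rule finite_subset) simp
  qed simp
  then have "finite (\<Union>x\<in>K. X \<inter> ball x r)" using K(1) by blast
  then show ?thesis by (rule rev_finite_subset) (use K(2) in auto)
qed

lemma delone_ne_UNIV:
  fixes X :: "(real ^ 'n) set"
  assumes "delone X"
  shows "X \<noteq> UNIV"
proof
  assume X: "X = UNIV"
  from assms obtain r where r: "r > 0" "\<exists>\<^sub>\<le>\<^sub>1 x. x \<in> X \<inter> ball (0 :: real ^ 'n) r"
    unfolding delone_def by blast
  obtain v :: "real ^ 'n" where "norm v = r / 2"
    using vector_choose_size[of "r / 2"] r(1) by auto
  then have "v \<noteq> 0" "v \<in> ball 0 r" "0 \<in> ball (0 :: real ^ 'n) r" using r(1) by auto
  with r(2) X show False by (auto simp: Uniq_def)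
qed

lemma repetitivity_function_attained:
  fixes X :: "(real ^ 'n) set"
  assumes X: "delone X" "repetitive X" and T: "T > 0"
  shows "repetitivity_bound X T (repetitivity_function X T)"
    and "repetitivity_bound X T M \<Longrightarrow> repetitivity_function X T \<le> M"
proof -
  define S where "S = {M. repetitivity_bound X T M}"
  define m where "m = Inf S"
  have ne: "S \<noteq> {}" using X(2) T unfolding repetitive_def S_def by blast
  have pos: "M > 0" if "M \<in> S" for M
    using that unfolding S_def repetitivity_bound_def by blast
  then have bdd: "bdd_below S" by (meson bdd_belowI less_imp_le)
  have good: "\<exists>x\<in>X. x \<in> cball c m \<and> patch X x T = patch X y T" if y: "y \<in> X" for c y
  proof -
    define F where "F = {x \<in> X \<inter> cball c (m + 1). patch X x T = patch X y T}"
    have fin: "finite F" using delone_finite_cball[OF X(1), of c "m + 1"] unfolding F_def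
      by (rule rev_finite_subset) auto
    have step: "\<exists>x\<in>F. dist c x < d" if d: "d > m" for d
    proof -
      obtain M where M: "M \<in> S" "M < min d (m + 1)"
        using cInf_lessD[OF ne, of "min d (m + 1)"] d unfolding m_def by auto
      then obtain x where "x \<in> X" "x \<in> cball c M" "patch X x T = patch X y T"
        using y unfolding S_def repetitivity_bound_def by blast
      with M(2) show ?thesis unfolding F_def by force
    qed
    then have Fne: "F \<noteq> {}" using less_add_one[of m] by blast
    obtain x where x: "x \<in> F" "\<And>z. z \<in> F \<Longrightarrow> dist c x \<le> dist c z"
      using arg_min_if_finite[OF fin Fne, of "dist c"] by (meson not_le)
    have "dist c x \<le> m"
      using step[of "dist c x"] x(2) by (meson not_le)
    with x(1) show ?thesis unfolding F_def by auto
  qed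
  have "m \<ge> 0" unfolding m_def using ne pos by (meson cInf_greatest less_imp_le)
  moreover have "m \<noteq> 0"
  proof
    assume m: "m = 0"
    obtain y where "y \<in> X" using X(1) unfolding delone_def by blast
    then have "c \<in> X" for c using good[of y c] m by auto
    then show False using delone_ne_UNIV[OF X(1)] by blast
  qed
  ultimately have mb: "repetitivity_bound X T m"
    unfolding repetitivity_bound_def using good by auto
  have le: "m \<le> M" if "repetitivity_bound X T M" for M
    unfolding m_def by (rule cInf_lower[OF _ bdd]) (use that in \<open>simp add: S_def\<close>)
  have eq: "repetitivity_function X T = m"
    unfolding repetitivity_function_def by (rule Least_equality) (use mb le in auto)
  show "repetitivity_bound X T (repetitivity_function X T)" using mb eq by simp
  show "repetitivity_bound X T M \<Longrightarrow> repetitivity_function X T \<le> M" using le eq by simp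
qed

end

theory Submission
  imports Defs
begin

text \<open>
  Componentwise it suffices to treat a real-valued weight. Suppose that the densities
  weight / volume of all boxes of width at least \<open>U\<close> lie in an interval of length \<open>d\<close>.
  By linear repetitivity there is a constant \<open>K\<close>, depending only on \<open>X\<close>, such that every box
  with sides between \<open>K U\<close> and \<open>2 K U\<close> contains, at distance at least \<open>U\<close> from its boundary,
  a translate together with its points of \<open>X\<close> of one fixed cube of side \<open>U\<close>. This copy takes up
  a fraction of at least \<open>\<theta> = (2 K)\<^sup>-\<^sup>n\<close> of the volume and always contributes the same density
  up to \<open>O(1 / U)\<close>, so the densities of these boxes lie in an interval of length
  \<open>(1 - \<theta>) d + O(1 / U)\<close>. Every box of width at least \<open>K U\<close> splits into such boxes.
  Iterating along \<open>U, K U, K\<^sup>2 U, \<dots>\<close>, the intervals shrink geometrically to the average value;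
  any ratio \<open>K\<^sup>-\<^sup>\<delta>\<close> with \<open>K\<^sup>-\<^sup>\<delta> > max (1 - \<theta>) (1 / K)\<close> is admissible, and the choice made is
  \<open>K\<^sup>-\<^sup>\<delta> = 1 - \<theta> / 2\<close>.
\<close>

section \<open>Side lengths, volume and surface area of boxes\<close>

lemma is_boxE:
  assumes "is_box B"
  obtains a b where "\<And>i. a $ i < b $ i" "B = cbox a b"
    "\<And>i. side_length B i = b $ i - a $ i"
  using assms side_length_cbox unfolding is_box_def by metis

lemma is_box_cbox: "(\<And>i. a $ i < b $ i) \<Longrightarrow> is_box (cbox a b)"
  unfolding is_box_def by blast

lemma side_length_pos: "is_box B \<Longrightarrow> 0 < side_length B i"
  by (erule is_boxE) simp

lemma box_volume_pos: "is_box B \<Longrightarrow> 0 < box_volume B"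
  unfolding box_volume_def by (simp add: prod_pos side_length_pos)

lemma box_volume_nonneg: "is_box B \<Longrightarrow> 0 \<le> box_volume B"
  using box_volume_pos by (rule less_imp_le)

lemma box_width_ge_iff: "U \<le> box_width B \<longleftrightarrow> (\<forall>i. U \<le> side_length B i)"
  unfolding box_width_def by (subst Min_ge_iff) auto

text \<open>Links the product of side lengths to Lebesgue measure, whose additivity over divisions
  then applies to \<open>box_volume\<close>.\<close>

lemma box_volume_eq_measure:
  assumes "is_box B"
  shows "box_volume B = measure lborel B"
proof -
  obtain a b where ab: "\<And>i. a $ i < b $ i" "B = cbox a b"
    "\<And>i. side_length B i = b $ i - a $ i"
    using assms by (rule is_boxE) blast
  have "cbox a b \<noteq> {}"
    using ab(1) by (simp add: interval_ne_empty_cart less_imp_le)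
  then show ?thesis
    using ab by (simp add: box_volume_def content_cbox_cart)
qed

lemma sum_box_volume_division:
  assumes "is_box B" "P division_of B" "\<forall>B'\<in>P. is_box B'"
  shows "(\<Sum>B'\<in>P. box_volume B') = box_volume B"
proof -
  obtain a b where "B = cbox a b" using assms(1) unfolding is_box_def by blast
  then have "sum (measure lborel) P = measure lborel B"
    using additive_content_division assms(2) by blast
  then show ?thesis
    using assms by (simp add: box_volume_eq_measure)
qed

text \<open>Each \<open>1 / side_length B i\<close> is at most \<open>1 / U\<close>. This turns
  every surface error into a relative error of order \<open>1 / U\<close> in the volume.\<close>

lemma surface_area_le:
  fixes B :: "(real ^ 'n) set"
  assumes "is_box B" "U \<le> box_width B" "0 < U"
  shows "surface_area B \<le> 2 * real CARD('n) / U * box_volume B"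
proof -
  have "(\<Sum>i\<in>UNIV. 1 / side_length B i) \<le> (\<Sum>i\<in>(UNIV :: 'n set). 1 / U)"
    using assms(2,3) unfolding box_width_ge_iff
    by (intro sum_mono) (simp add: frac_le)
  then have "2 * box_volume B * (\<Sum>i\<in>UNIV. 1 / side_length B i)
      \<le> 2 * box_volume B * (real CARD('n) / U)"
    using box_volume_pos[OF assms(1)] by (intro mult_left_mono) auto
  then show ?thesis
    unfolding surface_area_def by (simp add: field_simps)
qed

section \<open>Divisions of boxes obtained from divisions of their sides\<close>

text \<open>A cell is given by a choice \<open>p\<close> of one interval per coordinate. Distinct
  choices differ in some coordinate, and there the open intervals are already disjoint.\<close>

lemma grid_division:
  fixes D :: "'n::finite \<Rightarrow> (real \<times> real) set" and a b :: "real ^ 'n"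
  assumes fin: "\<And>i. finite (D i)"
    and le: "\<And>i p. p \<in> D i \<Longrightarrow> fst p \<le> snd p"
    and disj: "\<And>i p q. p \<in> D i \<Longrightarrow> q \<in> D i \<Longrightarrow> p \<noteq> q \<Longrightarrow>
        {fst p<..<snd p} \<inter> {fst q<..<snd q} = {}"
    and un: "\<And>i. (\<Union>p\<in>D i. {fst p..snd p}) = {a $ i..b $ i}"
  shows "(\<lambda>p. cbox (\<chi> i. fst (p i)) (\<chi> i. snd (p i))) ` PiE UNIV D division_of cbox a b"
    (is "?F ` ?I division_of _")
proof (rule division_ofI)
  show "finite (?F ` ?I)" using fin by (simp add: finite_PiE)
  fix K assume "K \<in> ?F ` ?I"
  then obtain p where p: "p \<in> ?I" "K = ?F p" by blast
  show "\<exists>a b. K = cbox a b" using p by blast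
  have "fst (p i) \<le> snd (p i)" for i
    using p(1) by (auto intro: le)
  then show "K \<noteq> {}" using p(2) by (simp add: interval_ne_empty_cart)
  show "K \<subseteq> cbox a b"
  proof
    fix x assume "x \<in> K"
    then have "x $ i \<in> {a $ i..b $ i}" for i
      unfolding un[symmetric] using p by (auto simp: mem_box_cart PiE_iff)
    then show "x \<in> cbox a b" by (simp add: mem_box_cart)
  qed
next
  fix K L assume "K \<in> ?F ` ?I" "L \<in> ?F ` ?I" "K \<noteq> L"
  then obtain p q where pq: "p \<in> ?I" "q \<in> ?I" "K = ?F p" "L = ?F q" "p \<noteq> q" by blast
  then obtain i where "p i \<noteq> q i" by blast
  then have i: "{fst (p i)<..<snd (p i)} \<inter> {fst (q i)<..<snd (q i)} = {}"
    using pq(1,2) by (intro disj[of _ i]) auto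
  have "x $ i \<in> {fst (p i)<..<snd (p i)} \<inter> {fst (q i)<..<snd (q i)}"
    if "x \<in> interior K" "x \<in> interior L" for x
    using that pq(3,4) by (simp add: interior_cbox mem_box_cart)
  with i show "interior K \<inter> interior L = {}" by blast
next
  show "\<Union> (?F ` ?I) = cbox a b"
  proof (rule antisym; rule subsetI)
    fix x assume "x \<in> \<Union> (?F ` ?I)"
    then obtain p where p: "p \<in> ?I" "x \<in> ?F p" by blast
    then have "x $ i \<in> {a $ i..b $ i}" for i
      unfolding un[symmetric] by (auto simp: mem_box_cart PiE_iff)
    then show "x \<in> cbox a b" by (simp add: mem_box_cart)
  next
    fix x assume "x \<in> cbox a b"
    then have "x $ i \<in> (\<Union>p\<in>D i. {fst p..snd p})" for i
      unfolding un by (simp add: mem_box_cart)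
    then have "\<exists>p\<in>D i. x $ i \<in> {fst p..snd p}" for i by blast
    then obtain p where "\<And>i. p i \<in> D i" "\<And>i. x $ i \<in> {fst (p i)..snd (p i)}" by metis
    then have "p \<in> ?I" "x \<in> ?F p" by (auto simp: mem_box_cart)
    then show "x \<in> \<Union> (?F ` ?I)" by blast
  qed
qed

lemma equal_parts:
  fixes a b U :: real
  assumes U: "0 < U" "U \<le> b - a"
  obtains D :: "(real \<times> real) set" where "finite D"
    "\<And>p. p \<in> D \<Longrightarrow> U \<le> snd p - fst p \<and> snd p - fst p \<le> 2 * U"
    "\<And>p q. p \<in> D \<Longrightarrow> q \<in> D \<Longrightarrow> p \<noteq> q \<Longrightarrow> {fst p<..<snd p} \<inter> {fst q<..<snd q} = {}"
    "(\<Union>p\<in>D. {fst p..snd p}) = {a..b}"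
proof -
  \<comment> \<open>The interval is cut into \<open>N\<close> equal parts of length
    \<open>h\<close>. Rounding down gives \<open>U \<le> h\<close>; since \<open>1 \<le> N\<close>,
    also \<open>N + 1 \<le> 2 * N\<close>, which gives \<open>h \<le> 2 * U\<close>.\<close>
  define N where "N = nat \<lfloor>(b - a) / U\<rfloor>"
  have N1: "1 \<le> N" using U by (simp add: N_def le_nat_iff le_floor_iff)
  have Nle: "real N \<le> (b - a) / U" using U by (simp add: N_def)
  have Nlt: "(b - a) / U < real N + 1" using U by (simp add: N_def)
  define h where "h = (b - a) / real N"
  have hN: "real N * h = b - a" using N1 by (simp add: h_def)
  have hU: "U \<le> h" using Nle N1 U by (simp add: h_def field_simps)
  have "b - a \<le> (real N + 1) * U" using Nlt U by (simp add: field_simps)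
  also have "\<dots> \<le> (2 * real N) * U" using N1 U by (intro mult_right_mono) auto
  finally have h2U: "h \<le> 2 * U" using N1 by (simp add: h_def field_simps)
  have h0: "0 < h" using U hU by linarith
  define I where "I k = (a + real k * h, a + real (Suc k) * h)" for k
  have mono: "real (Suc k) * h \<le> real l * h" if "k < l" for k l
    using that h0 by (intro mult_right_mono) auto
  show ?thesis
  proof (rule that[of "I ` {..<N}"])
    show "finite (I ` {..<N})" by simp
    show "U \<le> snd p - fst p \<and> snd p - fst p \<le> 2 * U" if "p \<in> I ` {..<N}" for p
      using that hU h2U by (auto simp: I_def algebra_simps)
    show "{fst p<..<snd p} \<inter> {fst q<..<snd q} = {}"
      if pq: "p \<in> I ` {..<N}" "q \<in> I ` {..<N}" "p \<noteq> q" for p q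
    proof -
      obtain k l where kl: "p = I k" "q = I l" "k \<noteq> l" using pq by blast
      then consider "k < l" | "l < k" by linarith
      then show ?thesis
        using mono[of k l] mono[of l k] kl(1,2) by cases (auto simp: I_def)
    qed
    have "(\<Union>k<n. {fst (I k)..snd (I k)}) = {a..a + real n * h}" if "1 \<le> n" for n
      using that
    proof (induction n rule: dec_induct)
      case base
      have "{..<1::nat} = {0}" by auto
      then show ?case by (simp add: I_def)
    next
      case (step n)
      have "(\<Union>k<Suc n. {fst (I k)..snd (I k)}) = {a..a + real n * h} \<union> {fst (I n)..snd (I n)}"
        using step.IH by (simp add: lessThan_Suc Un_commute)
      also have "\<dots> = {a..a + real (Suc n) * h}"
        unfolding I_def fst_conv snd_conv
        by (rule ivl_disj_un_two_touch) (use h0 in \<open>auto simp: mult_right_mono\<close>)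
      finally show ?case .
    qed
    from this[OF N1] show "(\<Union>p\<in>I ` {..<N}. {fst p..snd p}) = {a..b}"
      using hN by simp
  qed
qed

lemma division_into_comparable_boxes:
  fixes B :: "(real ^ 'n) set"
  assumes "is_box B" "0 < U" "U \<le> box_width B"
  obtains P where "P division_of B" "\<forall>B'\<in>P. is_box B' \<and> U \<le> box_width B'"
    "\<forall>B'\<in>P. \<forall>i. side_length B' i \<le> 2 * U"
proof -
  obtain a b where ab: "\<And>i. a $ i < b $ i" "B = cbox a b"
    "\<And>i. side_length B i = b $ i - a $ i"
    using assms(1) by (rule is_boxE) blast
  define parts where "parts i D \<longleftrightarrow> finite D \<and>
      (\<forall>p\<in>D. U \<le> snd p - fst p \<and> snd p - fst p \<le> 2 * U) \<and>
      (\<forall>p\<in>D. \<forall>q\<in>D. p \<noteq> q \<longrightarrow> {fst p<..<snd p} \<inter> {fst q<..<snd q} = {}) \<and>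
      (\<Union>p\<in>D. {fst p..snd p}) = {a $ i..b $ i}" for i and D :: "(real \<times> real) set"
  have "\<exists>D. parts i D" for i
  proof -
    have "U \<le> b $ i - a $ i" using assms(3) ab(3) by (simp add: box_width_ge_iff)
    then show ?thesis
    proof (rule equal_parts[OF assms(2)])
      fix D :: "(real \<times> real) set"
      assume "finite D"
        "\<And>p. p \<in> D \<Longrightarrow> U \<le> snd p - fst p \<and> snd p - fst p \<le> 2 * U"
        "\<And>p q. p \<in> D \<Longrightarrow> q \<in> D \<Longrightarrow> p \<noteq> q \<Longrightarrow> {fst p<..<snd p} \<inter> {fst q<..<snd q} = {}"
        "(\<Union>p\<in>D. {fst p..snd p}) = {a $ i..b $ i}"
      then have "parts i D" unfolding parts_def by simp
      then show ?thesis ..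
    qed
  qed
  then obtain D where "\<And>i. parts i (D i)" by metis
  then have D: "\<And>i. finite (D i)"
    "\<And>i p. p \<in> D i \<Longrightarrow> U \<le> snd p - fst p \<and> snd p - fst p \<le> 2 * U"
    "\<And>i p q. p \<in> D i \<Longrightarrow> q \<in> D i \<Longrightarrow> p \<noteq> q \<Longrightarrow> {fst p<..<snd p} \<inter> {fst q<..<snd q} = {}"
    "\<And>i. (\<Union>p\<in>D i. {fst p..snd p}) = {a $ i..b $ i}"
    unfolding parts_def by simp_all
  let ?F = "\<lambda>p. cbox (\<chi> i. fst (p i)) (\<chi> i. snd (p i)) :: (real ^ 'n) set"
  have le: "fst p \<le> snd p" if "p \<in> D i" for i p
    using D(2)[OF that] assms(2) by linarith
  have div: "?F ` PiE UNIV D division_of B"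
    unfolding ab(2) by (rule grid_division[OF D(1) le D(3,4)])
  have piece: "is_box (?F p)" "side_length (?F p) i = snd (p i) - fst (p i)"
    if "p \<in> PiE UNIV D" for p i
  proof -
    have "fst (p i) < snd (p i)" for i
      using D(2)[of "p i" i] that assms(2) by (auto simp: PiE_iff)
    then show "is_box (?F p)" "side_length (?F p) i = snd (p i) - fst (p i)"
      by (auto intro!: is_box_cbox simp: side_length_cbox)
  qed
  show ?thesis
  proof (rule that[OF div])
    have sides: "U \<le> snd (p i) - fst (p i) \<and> snd (p i) - fst (p i) \<le> 2 * U"
      if "p \<in> PiE UNIV D" for p i
      using that by (intro D(2)[of _ i]) auto
    then show "\<forall>B'\<in>?F ` PiE UNIV D. is_box B' \<and> U \<le> box_width B'"
      using piece unfolding box_width_ge_iff by auto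
    show "\<forall>B'\<in>?F ` PiE UNIV D. \<forall>i. side_length B' i \<le> 2 * U"
      using piece sides by auto
  qed
qed

text \<open>Cutting each side at \<open>c $ i\<close> and \<open>d $ i\<close> gives a grid with
  three intervals per coordinate whose middle cell is the inner box. The margins of \<open>U\<close>
  keep all other cells wide as well.\<close>

lemma division_around_inner_box:
  fixes a b c d :: "real ^ 'n"
  assumes U: "0 < U"
    and ac: "\<And>i. a $ i + U \<le> c $ i" and cd: "\<And>i. c $ i + U \<le> d $ i"
    and db: "\<And>i. d $ i + U \<le> b $ i"
  obtains P where "P division_of cbox a b" "\<forall>B'\<in>P. is_box B' \<and> U \<le> box_width B'"
    "cbox c d \<in> P"
proof -
  define D where "D i = {(a $ i, c $ i), (c $ i, d $ i), (d $ i, b $ i)}" for i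
  let ?F = "\<lambda>p. cbox (\<chi> i. fst (p i)) (\<chi> i. snd (p i)) :: (real ^ 'n) set"
  have wide: "U \<le> snd p - fst p" if "p \<in> D i" for i p
    using that ac[of i] cd[of i] db[of i] by (auto simp: D_def)
  have div: "?F ` PiE UNIV D division_of cbox a b"
  proof (rule grid_division)
    fix i
    show "finite (D i)" by (simp add: D_def)
    show "fst p \<le> snd p" if "p \<in> D i" for p
      using wide[OF that] U by linarith
    show "{fst p<..<snd p} \<inter> {fst q<..<snd q} = {}" if "p \<in> D i" "q \<in> D i" "p \<noteq> q" for p q
      using that ac[of i] cd[of i] db[of i] U by (auto simp: D_def)
    show "(\<Union>p\<in>D i. {fst p..snd p}) = {a $ i..b $ i}"
      using ac[of i] cd[of i] db[of i] U by (auto simp: D_def)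
  qed
  have piece: "is_box (?F p)" "U \<le> box_width (?F p)" if "p \<in> PiE UNIV D" for p
  proof -
    have U_le: "U \<le> snd (p i) - fst (p i)" for i
      using wide[of "p i" i] that by (auto simp: PiE_iff)
    have "fst (p i) < snd (p i)" for i
      using U_le[of i] U by linarith
    with U_le show "is_box (?F p)" "U \<le> box_width (?F p)"
      by (auto intro!: is_box_cbox simp: side_length_cbox box_width_ge_iff)
  qed
  have "(\<lambda>i. (c $ i, d $ i)) \<in> PiE UNIV D" by (auto simp: D_def)
  then have "?F (\<lambda>i. (c $ i, d $ i)) \<in> ?F ` PiE UNIV D" by (rule imageI)
  then have "cbox c d \<in> ?F ` PiE UNIV D" by simp
  then show ?thesis using that[OF div] piece by blast
qed

section \<open>Real-valued weights and bounds for their densities\<close>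

text \<open>One component of a local weight distribution. A single nonnegative constant
  \<open>C\<close> serves all three conditions and is a parameter, so that errors can be tracked
  explicitly.\<close>

definition scalar_weight_distribution ::
    "(real ^ 'n) set \<Rightarrow> real \<Rightarrow> real \<Rightarrow> ((real ^ 'n) set \<Rightarrow> real) \<Rightarrow> bool" where
  "scalar_weight_distribution X U0 C g \<longleftrightarrow>
     U0 \<ge> 0 \<and> C \<ge> 0 \<and>
     (\<forall>B \<in> boxes_wider_than U0. \<bar>g B\<bar> \<le> C * box_volume B) \<and>
     (\<forall>B \<in> boxes_wider_than U0. \<forall>t.
        (+) t ` B \<inter> X = (+) t ` (B \<inter> X) \<longrightarrow> \<bar>g ((+) t ` B) - g B\<bar> \<le> C * surface_area B) \<and>
     (\<forall>B \<in> boxes_wider_than U0. \<forall>P. P division_of B \<and> P \<subseteq> boxes_wider_than U0 \<longrightarrow>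
        \<bar>g B - (\<Sum>B'\<in>P. g B')\<bar> \<le> C * (\<Sum>B'\<in>P. surface_area B'))"

text \<open>The bounds are multiplied out by the volume so that they can be summed over a division.
  The width condition is not strict, since pieces of a division may have width exactly
  \<open>U\<close>.\<close>

definition density_bounds :: "((real ^ 'n) set \<Rightarrow> real) \<Rightarrow> real \<Rightarrow> real \<Rightarrow> real \<Rightarrow> bool" where
  "density_bounds g U lo hi \<longleftrightarrow>
     (\<forall>B. is_box B \<and> U \<le> box_width B \<longrightarrow>
        lo * box_volume B \<le> g B \<and> g B \<le> hi * box_volume B)"

lemma density_bounds_mono:
  "density_bounds g U lo hi \<Longrightarrow> hi \<le> hi' \<Longrightarrow> density_bounds g U lo hi'"
  using box_volume_nonneg unfolding density_bounds_def
  by (meson mult_right_mono order_trans)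

text \<open>The surface areas of the pieces are bounded by their volumes, which add up to that of
  \<open>B\<close>. The error is thus independent of the number of pieces.\<close>

lemma scalar_weight_division:
  fixes X :: "(real ^ 'n) set"
  assumes g: "scalar_weight_distribution X U0 C g"
    and U: "U0 < U"
    and B: "is_box B" "U \<le> box_width B"
    and P: "P division_of B" "\<forall>B'\<in>P. is_box B' \<and> U \<le> box_width B'"
  shows "\<bar>g B - (\<Sum>B'\<in>P. g B')\<bar> \<le> 2 * real CARD('n) * C / U * box_volume B"
proof -
  have U0: "0 \<le> U0" and C: "0 \<le> C"
    using g unfolding scalar_weight_distribution_def by auto
  have BP: "B \<in> boxes_wider_than U0" "P \<subseteq> boxes_wider_than U0"
    using B P(2) U unfolding boxes_wider_than_def by fastforce+
  have "\<bar>g B - (\<Sum>B'\<in>P. g B')\<bar> \<le> C * (\<Sum>B'\<in>P. surface_area B')"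
    using g BP P(1) unfolding scalar_weight_distribution_def by blast
  also have "\<dots> \<le> C * (\<Sum>B'\<in>P. 2 * real CARD('n) / U * box_volume B')"
    using P(2) U U0 C by (intro mult_left_mono sum_mono surface_area_le) auto
  also have "\<dots> = 2 * real CARD('n) * C / U * box_volume B"
    using sum_box_volume_division[OF B(1) P(1)] P(2)
    by (simp only: flip: sum_distrib_left) simp
  finally show ?thesis .
qed

text \<open>Every wide box splits into boxes with sides between \<open>U\<close> and
  \<open>2 * U\<close>, and its density is a weighted mean of theirs up to the additivity
  error.\<close>

lemma density_bounds_from_comparable_boxes:
  fixes X :: "(real ^ 'n) set"
  assumes g: "scalar_weight_distribution X U0 C g"
    and U: "U0 < U"
    and fat: "\<And>B. is_box B \<Longrightarrow> U \<le> box_width B \<Longrightarrow> (\<And>i. side_length B i \<le> 2 * U) \<Longrightarrow>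
        lo * box_volume B \<le> g B \<and> g B \<le> hi * box_volume B"
  shows "density_bounds g U (lo - 2 * real CARD('n) * C / U) (hi + 2 * real CARD('n) * C / U)"
  unfolding density_bounds_def
proof (intro allI impI, elim conjE)
  fix B :: "(real ^ 'n) set" assume B: "is_box B" "U \<le> box_width B"
  have "0 < U" using g U unfolding scalar_weight_distribution_def by auto
  then obtain P where P: "P division_of B" "\<forall>B'\<in>P. is_box B' \<and> U \<le> box_width B'"
    "\<forall>B'\<in>P. \<forall>i. side_length B' i \<le> 2 * U"
    using division_into_comparable_boxes B by metis
  have "(\<Sum>B'\<in>P. lo * box_volume B') \<le> (\<Sum>B'\<in>P. g B')"
    "(\<Sum>B'\<in>P. g B') \<le> (\<Sum>B'\<in>P. hi * box_volume B')"
    using fat P(2,3) by (auto intro!: sum_mono)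
  moreover have "(\<Sum>B'\<in>P. box_volume B') = box_volume B"
    using sum_box_volume_division[OF B(1) P(1)] P(2) by blast
  ultimately have "lo * box_volume B \<le> (\<Sum>B'\<in>P. g B')"
    "(\<Sum>B'\<in>P. g B') \<le> hi * box_volume B"
    by (simp_all flip: sum_distrib_left)
  with scalar_weight_division[OF g U B P(1,2)]
  show "(lo - 2 * real CARD('n) * C / U) * box_volume B \<le> g B \<and>
      g B \<le> (hi + 2 * real CARD('n) * C / U) * box_volume B"
    by (simp add: algebra_simps abs_le_iff)
qed

section \<open>Linear repetitivity and copies of a fixed cube\<close>

text \<open>The least radius is attained and is at most \<open>L * T\<close> for large
  \<open>T\<close>; enlarging the balls to radius \<open>L * T\<close> preserves the repetition
  property.\<close>

lemma linearly_repetitive_bound: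
  fixes X :: "(real ^ 'n) set"
  assumes "delone X" "linearly_repetitive X"
  obtains L T0 where "0 < L" "0 < T0" "\<And>T. T0 \<le> T \<Longrightarrow> repetitivity_bound X T (L * T)"
proof -
  have rep: "repetitive X" and O: "repetitivity_function X \<in> O[at_top](\<lambda>T. T)"
    using assms(2) unfolding linearly_repetitive_def by auto
  obtain L where L: "0 < L" "eventually (\<lambda>T. norm (repetitivity_function X T) \<le> L * norm T) at_top"
    using O by (rule landau_o.bigE)
  then obtain T1 where T1: "\<And>T. T1 \<le> T \<Longrightarrow> norm (repetitivity_function X T) \<le> L * norm T"
    unfolding eventually_at_top_linorder by blast
  show ?thesis
  proof (rule that[OF L(1), of "max T1 1"])
    show "0 < max T1 1" by simp
    fix T assume T: "max T1 1 \<le> T"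
    then have "repetitivity_function X T \<le> L * T" using T1[of T] by simp
    moreover have "cball c M \<subseteq> cball c (L * T)" if "M \<le> L * T" for c :: "real ^ 'n" and M
      using that by auto
    moreover have "repetitivity_bound X T (repetitivity_function X T)"
      using repetitivity_function_attained(1)[OF assms(1) rep] T by simp
    ultimately show "repetitivity_bound X T (L * T)"
      unfolding repetitivity_bound_def by (meson less_le_trans subsetD)
  qed
qed

text \<open>Supplies the hypothesis of translation invariance: a set inside the ball around
  \<open>y\<close> moves to \<open>x\<close> together with exactly its points of
  \<open>X\<close>.\<close>

lemma patch_eq_translate:
  assumes "patch X x T = patch X y T" "S \<subseteq> cball y T"
  shows "(+) (x - y) ` S \<inter> X = (+) (x - y) ` (S \<inter> X)"
proof -
  \<comment> \<open>The centres are kept generic because the two inclusions use this in opposite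
    directions.\<close>
  have transfer: "z - u + v \<in> X" if "patch X u T = patch X v T" "z \<in> X" "dist u z \<le> T" for u v z
  proof -
    have "z - u \<in> patch X v T"
      using that unfolding that(1)[symmetric] patch_def by auto
    then show ?thesis unfolding patch_def by (auto simp: algebra_simps)
  qed
  have near: "dist y z \<le> T" if "z \<in> S" for z using assms(2) that by auto
  show ?thesis
  proof (intro antisym subsetI)
    fix v assume "v \<in> (+) (x - y) ` S \<inter> X"
    then obtain z where z: "z \<in> S" "v = x - y + z" "v \<in> X" by blast
    have "dist x v = dist y z" unfolding z(2) by (simp add: dist_norm)
    then have "v - x + y \<in> X" using transfer[OF assms(1) z(3)] near[OF z(1)] by simp
    then show "v \<in> (+) (x - y) ` (S \<inter> X)" using z by (simp add: algebra_simps)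
  next
    fix v assume "v \<in> (+) (x - y) ` (S \<inter> X)"
    then obtain z where z: "z \<in> S" "v = x - y + z" "z \<in> X" by blast
    have "z - y + x \<in> X" using transfer[OF assms(1)[symmetric] z(3)] near[OF z(1)] by simp
    also have "z - y + x = v" using z(2) by simp
    finally show "v \<in> (+) (x - y) ` S \<inter> X" using z by blast
  qed
qed

lemma cbox_cube_subset_cball:
  fixes y :: "real ^ 'n"
  shows "cbox y (\<chi> i. y $ i + U) \<subseteq> cball y (real CARD('n) * U)"
proof
  fix z assume "z \<in> cbox y (\<chi> i. y $ i + U)"
  then have z: "y $ i \<le> z $ i" "z $ i \<le> y $ i + U" for i by (auto simp: mem_box_cart)
  have "norm (z - y) \<le> (\<Sum>i\<in>UNIV. \<bar>(z - y) $ i\<bar>)" by (rule norm_le_l1_cart)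
  also have "\<dots> \<le> (\<Sum>i\<in>(UNIV :: 'n set). U)"
    proof (rule sum_mono)
    show "\<bar>(z - y) $ i\<bar> \<le> U" for i using z[of i] by simp
  qed
  finally show "z \<in> cball y (real CARD('n) * U)"
    by (simp add: dist_norm norm_minus_commute)
qed

text \<open>The patch of \<open>y\<close> recurs at some \<open>x\<close> within \<open>M\<close> of
  the midpoint of \<open>B\<close>. Half of each side is at least \<open>M + 2 * U\<close>, which
  leaves room above \<open>x $ i\<close> for the cube and a margin \<open>U\<close>.\<close>

lemma copy_of_cube_in_comparable_box:
  fixes X :: "(real ^ 'n) set"
  assumes rep: "repetitivity_bound X (real CARD('n) * U) M" and y: "y \<in> X"
    and U: "0 < U" and B: "is_box B" "2 * M + 4 * U \<le> box_width B"
  obtains t P where "P division_of B" "\<forall>B'\<in>P. is_box B' \<and> U \<le> box_width B'"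
    "(+) t ` cbox y (\<chi> i. y $ i + U) \<in> P"
    "(+) t ` cbox y (\<chi> i. y $ i + U) \<inter> X = (+) t ` (cbox y (\<chi> i. y $ i + U) \<inter> X)"
proof -
  obtain a b where ab: "\<And>i. a $ i < b $ i" "B = cbox a b"
    "\<And>i. side_length B i = b $ i - a $ i"
    using B(1) by (rule is_boxE) blast
  define m where "m = (\<chi> i. (a $ i + b $ i) / 2)"
  obtain x where x: "x \<in> X" "x \<in> cball m M"
    "patch X x (real CARD('n) * U) = patch X y (real CARD('n) * U)"
    using rep y unfolding repetitivity_bound_def by blast
  have margin: "a $ i + U \<le> x $ i" "x $ i + U + U \<le> b $ i" for i
  proof -
    have "\<bar>(m - x) $ i\<bar> \<le> M"
      using component_le_norm_cart[of "m - x" i] x(2) by (simp add: dist_norm)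
    moreover have "2 * M + 4 * U \<le> b $ i - a $ i"
      using B(2) ab(3) by (simp add: box_width_ge_iff)
    moreover have "2 * m $ i = a $ i + b $ i" by (simp add: m_def)
    ultimately show "a $ i + U \<le> x $ i" "x $ i + U + U \<le> b $ i"
      using U unfolding vector_minus_component abs_le_iff by linarith+
  qed
  have "x - y + (\<chi> i. y $ i + U) = (\<chi> i. x $ i + U)" by (simp add: vec_eq_iff)
  then have img: "(+) (x - y) ` cbox y (\<chi> i. y $ i + U) = cbox x (\<chi> i. x $ i + U)"
    using cbox_translation[of "x - y" y "\<chi> i. y $ i + U"] by simp
  obtain P where "P division_of cbox a b" "\<forall>B'\<in>P. is_box B' \<and> U \<le> box_width B'"
    "cbox x (\<chi> i. x $ i + U) \<in> P"
    by (rule division_around_inner_box[OF U, of a x "\<chi> i. x $ i + U" b]) (use margin in auto)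
  then show ?thesis
    using that[of P "x - y"] ab(2) img
      patch_eq_translate[OF x(3) cbox_cube_subset_cball] by simp
qed

section \<open>Contraction of the density interval from one scale to the next\<close>

text \<open>A copy of one cube of density \<open>\<rho>\<close> fills a fraction at least
  \<open>\<theta>\<close> of every box with sides between \<open>K * U\<close> and
  \<open>2 * K * U\<close>. It raises the lower bound by \<open>\<theta> * (\<rho> - lo)\<close> and
  lowers the upper one by \<open>\<theta> * (hi - \<rho>)\<close>; the sum of the two gains does not
  depend on \<open>\<rho>\<close>.\<close>

lemma density_bounds_contract:
  fixes X :: "(real ^ 'n) set"
  assumes g: "scalar_weight_distribution X U0 C g"
    and U: "U0 < U" and K: "1 \<le> K"
    and rep: "repetitivity_bound X (real CARD('n) * U) M" and y: "y \<in> X"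
    and KU: "2 * M + 4 * U \<le> K * U"
    and lohi: "density_bounds g U lo hi"
  obtains lo' where "density_bounds g (K * U) lo'
    (lo' + (1 - 1 / (2 * K) ^ CARD('n)) * (hi - lo) + 12 * real CARD('n) * C / U)"
proof -
  define Q where "Q = cbox y (\<chi> i. y $ i + U)"
  \<comment> \<open>The relative error of one application of additivity or translation invariance at
    scale \<open>U\<close>.\<close>
  define E where "E = 2 * real CARD('n) * C / U"
  define \<theta> where "\<theta> = 1 / (2 * K) ^ CARD('n)"
  have "0 \<le> U0" and C: "0 \<le> C"
    using g unfolding scalar_weight_distribution_def by auto
  then have U_pos: "0 < U" using U by simp
  have E0: "0 \<le> E" using C U_pos by (simp add: E_def)
  have \<theta>0: "0 < \<theta>" using K by (simp add: \<theta>_def)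
  have UKU: "U \<le> K * U" using K U_pos by simp
  have Qbox: "is_box Q" and Qside: "side_length Q i = U" for i
    using U_pos by (auto simp: Q_def side_length_cbox intro!: is_box_cbox)
  have Qwidth: "box_width Q \<ge> U" by (simp add: box_width_ge_iff Qside)
  have Qvol: "box_volume Q = U ^ CARD('n)" by (simp add: box_volume_def Qside)
  define V where "V = box_volume Q"
  have V0: "0 < V" unfolding V_def by (rule box_volume_pos[OF Qbox])
  define \<rho> where "\<rho> = g Q / V"
  have gQ: "g Q = \<rho> * V" using V0 by (simp add: \<rho>_def)
  have "lo * V \<le> \<rho> * V" "\<rho> * V \<le> hi * V"
    using lohi Qbox Qwidth unfolding density_bounds_def gQ[symmetric] by (auto simp: V_def)
  then have \<rho>: "lo \<le> \<rho>" "\<rho> \<le> hi" using V0 by auto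
  have Qwide: "Q \<in> boxes_wider_than U0"
    using Qbox Qwidth U by (simp add: boxes_wider_than_def)
  have fat: "(lo + \<theta> * (\<rho> - lo) - 2 * E) * box_volume B \<le> g B \<and>
      g B \<le> (hi - \<theta> * (hi - \<rho>) + 2 * E) * box_volume B"
    if B: "is_box B" "K * U \<le> box_width B" "\<And>i. side_length B i \<le> 2 * (K * U)" for B
  proof -
    have "2 * M + 4 * U \<le> box_width B" using KU B(2) by linarith
    from copy_of_cube_in_comparable_box[OF rep y U_pos B(1) this]
    obtain t P where P: "P division_of B" "\<forall>B'\<in>P. is_box B' \<and> U \<le> box_width B'"
      and Q': "(+) t ` Q \<in> P" and Qt: "(+) t ` Q \<inter> X = (+) t ` (Q \<inter> X)"
      unfolding Q_def by metis
    let ?Q = "(+) t ` Q" and ?R = "P - {(+) t ` Q}"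
    let ?v = "box_volume B"
    have "finite P" using P(1) by blast
    then have split: "sum h P = h ?Q + sum h ?R" for h :: "(real ^ 'n) set \<Rightarrow> real"
      using Q' by (simp add: sum.remove)
    have "?Q = cbox (t + y) (t + (\<chi> i. y $ i + U))"
      unfolding Q_def by (rule cbox_translation[symmetric])
    then have "side_length ?Q i = U" for i
      using U_pos by (simp add: side_length_cbox)
    then have vol_Q': "box_volume ?Q = V" by (simp add: box_volume_def V_def Qside)
    have vol_P: "(\<Sum>B'\<in>P. box_volume B') = ?v"
      using sum_box_volume_division[OF B(1) P(1)] P(2) by blast
    have vol_R: "(\<Sum>B'\<in>?R. box_volume B') = ?v - V"
      using split[of box_volume] vol_P vol_Q' by simp
    have "0 \<le> (\<Sum>B'\<in>?R. box_volume B')"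
      using P(2) by (intro sum_nonneg) (auto intro: box_volume_nonneg)
    then have Vv: "V \<le> ?v" using vol_R by simp
    have "?v \<le> (\<Prod>i\<in>(UNIV :: 'n set). 2 * (K * U))"
      unfolding box_volume_def using B(3) side_length_pos[OF B(1)]
      by (intro prod_mono) (auto intro: less_imp_le)
    also have "\<dots> = V / \<theta>"
      by (simp add: V_def Qvol \<theta>_def power_mult_distrib)
    finally have \<theta>v: "\<theta> * ?v \<le> V" using \<theta>0 by (simp add: field_simps)
    have "\<bar>g ?Q - g Q\<bar> \<le> C * surface_area Q"
      using g Qwide Qt unfolding scalar_weight_distribution_def by blast
    also have "\<dots> \<le> C * (2 * real CARD('n) / U * V)"
      unfolding V_def using C by (intro mult_left_mono surface_area_le Qbox Qwidth U_pos)
    also have "\<dots> = E * V" by (simp add: E_def)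
    also have "\<dots> \<le> E * ?v" using Vv E0 by (rule mult_left_mono)
    finally have 1: "\<bar>g ?Q - \<rho> * V\<bar> \<le> E * ?v" unfolding gQ .
    have "U \<le> box_width B" using UKU B(2) by linarith
    from scalar_weight_division[OF g U B(1) this P]
    have 2: "\<bar>g B - (g ?Q + sum g ?R)\<bar> \<le> E * ?v"
      unfolding split[of g] E_def .
    have "(\<Sum>B'\<in>?R. lo * box_volume B') \<le> sum g ?R" "sum g ?R \<le> (\<Sum>B'\<in>?R. hi * box_volume B')"
      using lohi P(2) unfolding density_bounds_def by (auto intro!: sum_mono)
    then have 3: "lo * (?v - V) \<le> sum g ?R" "sum g ?R \<le> hi * (?v - V)"
      by (simp_all add: vol_R flip: sum_distrib_left)
    \<comment> \<open>With \<open>V\<close> for the volume of the copy, the lower bound is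
      \<open>lo * ?v + (\<rho> - lo) * V\<close>. As \<open>\<rho>\<close> lies between
      \<open>lo\<close> and \<open>hi\<close>, \<open>V\<close> may be replaced by the smaller
      \<open>\<theta> * ?v\<close>; likewise above.\<close>
    have 4: "(\<rho> - lo) * (\<theta> * ?v) \<le> (\<rho> - lo) * V" "(hi - \<rho>) * (\<theta> * ?v) \<le> (hi - \<rho>) * V"
      using \<rho> \<theta>v by (auto intro!: mult_left_mono)
    show ?thesis
      using 1 2 3 4 by (simp add: algebra_simps abs_le_iff)
  qed
  have "U0 < K * U" using U UKU by linarith
  from density_bounds_from_comparable_boxes[OF g this fat]
  have db: "density_bounds g (K * U)
      (lo + \<theta> * (\<rho> - lo) - 2 * E - 2 * real CARD('n) * C / (K * U))
      (hi - \<theta> * (hi - \<rho>) + 2 * E + 2 * real CARD('n) * C / (K * U))"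
    (is "density_bounds _ _ (_ - ?F) _") by blast
  define lo' where "lo' = lo + \<theta> * (\<rho> - lo) - 2 * E - ?F"
  define hi' where "hi' = hi - \<theta> * (hi - \<rho>) + 2 * E + ?F"
  \<comment> \<open>Each end of the interval loses \<open>2 * E\<close> inside the comparable boxes
    and \<open>?F\<close> in passing to all boxes, at most \<open>6 * E\<close> in total.\<close>
  have "hi' = lo' + (1 - \<theta>) * (hi - lo) + 4 * E + 2 * ?F"
    unfolding lo'_def hi'_def by algebra
  moreover have "?F \<le> E"
    unfolding E_def using C UKU U_pos by (intro divide_left_mono) auto
  ultimately have "hi' \<le> lo' + (1 - \<theta>) * (hi - lo) + 6 * E" by linarith
  moreover have "6 * E = 12 * real CARD('n) * C / U" by (simp add: E_def)
  ultimately have "hi' \<le> lo' + (1 - \<theta>) * (hi - lo) + 12 * real CARD('n) * C / U" by simp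
  then show ?thesis
    using that density_bounds_mono[OF db[folded lo'_def hi'_def]] unfolding \<theta>_def by blast
qed

section \<open>Convergence of the density intervals to the average value\<close>

lemma scalar_weight_average:
  fixes X :: "(real ^ 'n) set"
  assumes X: "delone X" "linearly_repetitive X"
  obtains \<delta> where "0 < \<delta>"
    "\<And>U0 C g. scalar_weight_distribution X U0 C g \<Longrightarrow>
      \<exists>f A U. \<forall>B\<in>boxes_wider_than U.
        \<bar>g B / box_volume B - f\<bar> \<le> A * box_width B powr (-\<delta>)"
proof -
  let ?n = "real CARD('n)"
  have n1: "1 \<le> ?n" by (simp add: Suc_le_eq)
  obtain L T0 where L: "0 < L" and T0: "0 < T0"
    and rep: "\<And>T. T0 \<le> T \<Longrightarrow> repetitivity_bound X T (L * T)"
    by (rule linearly_repetitive_bound[OF X]) blast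
  obtain y where y: "y \<in> X" using X(1) unfolding delone_def by blast
  \<comment> \<open>Chosen so that \<open>2 * M + 4 * U = K * U\<close> for
    \<open>M = L * (?n * U)\<close>, the repetition radius of patches that contain a cube of side
    \<open>U\<close>.\<close>
  define K where "K = 2 * (L * ?n) + 4"
  have K4: "4 \<le> K" using L by (simp add: K_def)
  define \<theta> where "\<theta> = 1 / (2 * K) ^ CARD('n)"
  have \<theta>: "0 < \<theta>" "\<theta> \<le> 1" 
    using K4 one_le_power[of "2 * K" "CARD('n)"] by (auto simp: \<theta>_def divide_le_eq_1)
  \<comment> \<open>Half of the gain \<open>\<theta>\<close> is kept as contraction, the other half
    absorbs the errors. Moreover \<open>1 / K \<le> 1 / 2 \<le> q\<close>, so the errors decay at
    least as fast as the intervals.\<close>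
  define q where "q = 1 - \<theta> / 2"
  have q: "1 / 2 \<le> q" "q < 1" using \<theta> by (simp_all add: q_def)
  define \<delta> where "\<delta> = - log K q"
  have \<delta>: "0 < \<delta>" using q K4 by (simp add: \<delta>_def log_less_zero_cancel_iff)
  have K_powr: "K powr (-\<delta>) = q" using q K4 by (simp add: \<delta>_def)
  show ?thesis
  proof (rule that[OF \<delta>])
    fix U0 C :: real and g
    assume g: "scalar_weight_distribution X U0 C g"
    then have U0: "0 \<le> U0" and C: "0 \<le> C"
      unfolding scalar_weight_distribution_def by auto
    \<comment> \<open>Above \<open>U0\<close>, so that boxes of this width lie in the domain of the
      weight, and above \<open>T0\<close>, so that the linear bound applies.\<close>
    define U1 where "U1 = max U0 T0 + 1"
    have U1: "U0 < U1" "T0 \<le> U1" "0 < U1" using T0 by (auto simp: U1_def)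
    define E where "E = 12 * ?n * C / U1"
    \<comment> \<open>\<open>2 * C\<close> is the length of the initial interval from
      \<open>-C\<close> to \<open>C\<close>; \<open>2 * E / \<theta>\<close> makes the error at most
      \<open>\<theta> / 2\<close> times the interval length at every step.\<close>
    define A where "A = max (2 * C) (2 * E / \<theta>)"
    have "2 * E / \<theta> \<le> A" by (simp add: A_def)
    then have EA: "E \<le> A * (\<theta> / 2)" using \<theta> by (simp add: field_simps)
    have A0: "0 \<le> A" using C by (simp add: A_def)
    have K_pow: "1 \<le> K ^ m" for m using K4 by (simp add: one_le_power)
    have "\<exists>lo. density_bounds g (U1 * K ^ m) lo (lo + A * q ^ m)" for m
    proof (induction m)
      case 0
      have "density_bounds g U1 (-C) C"
        unfolding density_bounds_def
      proof (intro allI impI, elim conjE)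
        fix B :: "(real ^ 'n) set" assume "is_box B" "U1 \<le> box_width B"
        then have "B \<in> boxes_wider_than U0" using U1 by (simp add: boxes_wider_than_def)
        then have "\<bar>g B\<bar> \<le> C * box_volume B"
          using g unfolding scalar_weight_distribution_def by blast
        then show "- C * box_volume B \<le> g B \<and> g B \<le> C * box_volume B"
          by (simp add: abs_le_iff)
      qed
      then have "density_bounds g U1 (-C) (-C + A)"
        by (rule density_bounds_mono) (simp add: A_def)
      then show ?case unfolding power_0 mult_1_right by blast
    next
      case (Suc m)
      then obtain lo where lo: "density_bounds g (U1 * K ^ m) lo (lo + A * q ^ m)" ..
      let ?U = "U1 * K ^ m"
      have "U1 \<le> ?U" using U1 K_pow[of m] by simp
      then have U: "U0 < ?U" "T0 \<le> ?U" using U1 by linarith+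
      moreover have "1 * ?U \<le> ?n * ?U"
        using n1 U T0 by (intro mult_right_mono) linarith+
      ultimately have "T0 \<le> ?n * ?U" by linarith
      note rep' = rep[OF this]
      have "1 \<le> K" "2 * (L * (?n * ?U)) + 4 * ?U \<le> K * ?U"
        using K4 by (auto simp: K_def algebra_simps)
      from density_bounds_contract[OF g U(1) this(1) rep' y this(2) lo]
      obtain lo' where lo': "density_bounds g (K * ?U) lo'
          (lo' + (1 - \<theta>) * (A * q ^ m) + 12 * ?n * C / ?U)"
        unfolding \<theta>_def by auto
      have "12 * ?n * C / ?U = E * (1 / K) ^ m"
        by (simp add: E_def power_one_over field_simps)
      also have "\<dots> \<le> (A * (\<theta> / 2)) * q ^ m"
      proof (intro mult_mono power_mono EA)
        have "1 / K \<le> 1 / 2" using K4 by (intro divide_left_mono) auto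
        then show "1 / K \<le> q" using q by linarith
      qed (use A0 \<theta> K4 in auto)
      finally have "(1 - \<theta>) * (A * q ^ m) + 12 * ?n * C / ?U \<le> A * q ^ Suc m"
        by (simp add: q_def algebra_simps)
      then have "density_bounds g (K * ?U) lo' (lo' + A * q ^ Suc m)"
        using lo' by (intro density_bounds_mono[OF lo']) simp
      then show ?case by (auto simp: mult_ac)
    qed
    then obtain lo where lo: "\<And>m. density_bounds g (U1 * K ^ m) (lo m) (lo m + A * q ^ m)"
      by metis
    have density: "lo m \<le> g B / box_volume B \<and> g B / box_volume B \<le> lo m + A * q ^ m"
      if "is_box B" "U1 * K ^ m \<le> box_width B" for B m
      using lo[of m] that box_volume_pos[OF that(1)]
      unfolding density_bounds_def by (simp add: field_simps)
    \<comment> \<open>A cube wide enough for both scales has its density in both intervals, so no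
      lower end exceeds any upper end.\<close>
    have cross: "lo m \<le> lo k + A * q ^ k" for m k
    proof -
      define S where "S = U1 * K ^ max m k"
      have "K ^ m \<le> K ^ max m k" "K ^ k \<le> K ^ max m k"
        using K4 by (auto intro: power_increasing)
      then have S: "U1 * K ^ m \<le> S" "U1 * K ^ k \<le> S" using U1 by (auto simp: S_def)
      have "0 < S" using U1 K4 by (simp add: S_def)
      then have "is_box (cbox 0 (\<chi> i. S) :: (real ^ 'n) set)"
        "box_width (cbox 0 (\<chi> i. S) :: (real ^ 'n) set) \<ge> S"
        by (auto intro!: is_box_cbox simp: box_width_ge_iff side_length_cbox)
      then show ?thesis using density S by (meson order_trans)
    qed
    \<comment> \<open>The supremum of the lower ends therefore lies in all the intervals.\<close>
    define f where "f = (SUP m. lo m)"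
    have f: "lo m \<le> f" "f \<le> lo m + A * q ^ m" for m
      unfolding f_def using cross[of _ 0] cross[of _ m]
      by (auto intro!: cSUP_upper cSUP_least bdd_aboveI2)
    have "\<bar>g B / box_volume B - f\<bar> \<le> A * K powr \<delta> * U1 powr \<delta> * box_width B powr (-\<delta>)"
      if "B \<in> boxes_wider_than U1" for B
    proof -
      have B: "is_box B" "U1 < box_width B" using that by (auto simp: boxes_wider_than_def)
      define x where "x = box_width B / U1"
      have x: "1 \<le> x" using B U1 by (simp add: x_def)
      \<comment> \<open>The largest scale \<open>U1 * K ^ m\<close> not exceeding the width of
        \<open>B\<close>. Rounding down loses less than one step, which costs the factor
        \<open>K powr \<delta>\<close>.\<close>
      define m where "m = nat \<lfloor>log K x\<rfloor>"
      have m: "real m \<le> log K x" "log K x - 1 \<le> real m"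
        using x K4 by (auto simp: m_def le_floor_iff)
      have "K ^ m = K powr real m" using K4 by (simp add: powr_realpow)
      also have "\<dots> \<le> K powr log K x" using m(1) K4 by (intro powr_mono) auto
      also have "\<dots> = x" using x K4 by simp
      finally have "U1 * K ^ m \<le> box_width B" using U1 by (simp add: x_def field_simps)
      then have "\<bar>g B / box_volume B - f\<bar> \<le> A * q ^ m"
        using density[OF B(1), of m] f[of m] by linarith
      also have "q ^ m = K powr (-\<delta> * real m)"
        unfolding powr_powr[symmetric] K_powr using q by (simp add: powr_realpow)
      also have "A * \<dots> \<le> A * K powr (\<delta> + log K x * (-\<delta>))"
        using mult_left_mono[OF m(2), of \<delta>] \<delta> K4 A0
        by (intro mult_left_mono powr_mono) (auto simp: algebra_simps)
      also have "K powr (\<delta> + log K x * (-\<delta>)) = K powr \<delta> * x powr (-\<delta>)"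
        using x K4 unfolding powr_add powr_powr[symmetric] by simp
      also have "x powr (-\<delta>) = U1 powr \<delta> * box_width B powr (-\<delta>)"
        using B U1 by (simp add: x_def powr_divide powr_minus field_simps)
      finally show ?thesis by (simp add: mult.assoc)
    qed
    then show "\<exists>f A U. \<forall>B\<in>boxes_wider_than U.
        \<bar>g B / box_volume B - f\<bar> \<le> A * box_width B powr (-\<delta>)" by blast
  qed
qed

section \<open>From components to vector-valued weights\<close>

lemma surface_area_nonneg: "is_box B \<Longrightarrow> 0 \<le> surface_area B"
  unfolding surface_area_def
  by (intro mult_nonneg_nonneg sum_nonneg) (auto simp: box_volume_nonneg less_imp_le side_length_pos)

text \<open>A component is bounded in absolute value by the Euclidean norm, so all three conditions
  pass to it.\<close>

lemma local_weight_distribution_component: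
  fixes X :: "(real ^ 'n) set"
  assumes w: "local_weight_distribution X s U0 w" and j: "j < s"
  obtains C where "scalar_weight_distribution X U0 C (\<lambda>B. w B j)"
proof -
  have comp: "\<bar>v j\<bar> \<le> C' * V" if "L2_set v {..<s} \<le> C * V" "C \<le> C'" "0 \<le> V" for v C C' V
  proof -
    have "\<bar>v j\<bar> = L2_set v {j}" by simp
    also have "\<dots> \<le> L2_set v {..<s}"
      unfolding L2_set_def using j by (intro real_sqrt_le_mono sum_mono2) auto
    also note that(1)
    also have "C * V \<le> C' * V" using that(2,3) by (rule mult_right_mono)
    finally show ?thesis .
  qed
  obtain Ca Cb Cc where
    a: "\<And>B. B \<in> boxes_wider_than U0 \<Longrightarrow> L2_set (w B) {..<s} \<le> Ca * box_volume B" and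
    b: "\<And>B t. B \<in> boxes_wider_than U0 \<Longrightarrow> (+) t ` B \<inter> X = (+) t ` (B \<inter> X) \<Longrightarrow>
        L2_set (\<lambda>j. w ((+) t ` B) j - w B j) {..<s} \<le> Cb * surface_area B" and
    c: "\<And>B P. B \<in> boxes_wider_than U0 \<Longrightarrow> P division_of B \<Longrightarrow> P \<subseteq> boxes_wider_than U0 \<Longrightarrow>
        L2_set (\<lambda>j. w B j - (\<Sum>B'\<in>P. w B' j)) {..<s} \<le> Cc * (\<Sum>B'\<in>P. surface_area B')"
    using w unfolding local_weight_distribution_def by (elim conjE exE) blast
  \<comment> \<open>The given constants carry no sign; including 0 makes \<open>C\<close>
    nonnegative.\<close>
  define C where "C = Max {0, Ca, Cb, Cc}"
  have C: "0 \<le> C" "Ca \<le> C" "Cb \<le> C" "Cc \<le> C" by (auto simp: C_def)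
  have box: "is_box B" if "B \<in> boxes_wider_than U0" for B :: "(real ^ 'n) set"
    using that by (simp add: boxes_wider_than_def)
  have U0: "0 \<le> U0" using w unfolding local_weight_distribution_def by blast
  have "scalar_weight_distribution X U0 C (\<lambda>B. w B j)"
    unfolding scalar_weight_distribution_def
  proof (intro conjI ballI allI impI)
    fix B :: "(real ^ 'n) set" assume B: "B \<in> boxes_wider_than U0"
    show "\<bar>w B j\<bar> \<le> C * box_volume B"
      by (rule comp[OF a[OF B] C(2) box_volume_nonneg[OF box[OF B]]])
    show "\<bar>w ((+) t ` B) j - w B j\<bar> \<le> C * surface_area B"
      if "(+) t ` B \<inter> X = (+) t ` (B \<inter> X)" for t
      by (rule comp[OF b[OF B that] C(3) surface_area_nonneg[OF box[OF B]]])
    fix P assume "P division_of B \<and> P \<subseteq> boxes_wider_than U0"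
    then have P: "P division_of B" "P \<subseteq> boxes_wider_than U0" by blast+
    have "0 \<le> (\<Sum>B'\<in>P. surface_area B')"
      using P(2) by (intro sum_nonneg surface_area_nonneg box) blast
    then show "\<bar>w B j - (\<Sum>B'\<in>P. w B' j)\<bar> \<le> C * (\<Sum>B'\<in>P. surface_area B')"
      by (rule comp[OF c[OF B P] C(4)])
  qed (use C(1) U0 in auto)
  then show ?thesis by (rule that)
qed

theorem theorem5p1:
  fixes X :: "(real ^ 'n) set"
  assumes "delone X" and "linearly_repetitive X"
  shows "\<exists>\<delta>>0. \<forall>s U0 w. local_weight_distribution X s U0 w \<longrightarrow>
           (\<exists>f \<in> topspace (Euclidean_space s).
              (\<lambda>B. L2_set (\<lambda>j. w B j / box_volume B - f j) {..<s})
                \<in> O[width_to_infinity](\<lambda>B. box_width B powr (-\<delta>)))"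
proof -
  \<comment> \<open>The exponent is fixed before any weight is considered, so it serves all
    components and all \<open>s\<close>.\<close>
  obtain \<delta> where \<delta>: "0 < \<delta>"
    "\<And>U0 C g. scalar_weight_distribution X U0 C g \<Longrightarrow>
      \<exists>f A U. \<forall>B\<in>boxes_wider_than U.
        \<bar>g B / box_volume B - f\<bar> \<le> A * box_width B powr (-\<delta>)"
    by (rule scalar_weight_average[OF assms]) blast
  have "\<exists>f \<in> topspace (Euclidean_space s).
      (\<lambda>B. L2_set (\<lambda>j. w B j / box_volume B - f j) {..<s})
        \<in> O[width_to_infinity](\<lambda>B. box_width B powr (-\<delta>))"
    if w: "local_weight_distribution X s U0 w" for s U0 w
  proof -
    have "\<exists>f A U. \<forall>B\<in>boxes_wider_than U.
        \<bar>w B j / box_volume B - f\<bar> \<le> A * box_width B powr (-\<delta>)" if "j < s" for j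
      using local_weight_distribution_component[OF w that] \<delta>(2) by metis
    then obtain f A U where f: "\<And>j B. j < s \<Longrightarrow> B \<in> boxes_wider_than (U j) \<Longrightarrow>
        \<bar>w B j / box_volume B - f j\<bar> \<le> A j * box_width B powr (-\<delta>)"
      by metis
    have ev: "eventually (\<lambda>B. \<forall>j\<in>{..<s}.
        \<bar>w B j / box_volume B - f j\<bar> \<le> A j * box_width B powr (-\<delta>)) width_to_infinity"
      using f by (intro eventually_ball_finite) (auto simp: eventually_width_to_infinity)
    \<comment> \<open>Only the values of \<open>f\<close> below \<open>s\<close> are controlled;
      vanishing from \<open>s\<close> on puts \<open>F\<close> in the carrier of the Euclidean
      space.\<close>
    define F where "F j = (if j < s then f j else 0)" for j
    have "(\<lambda>B. L2_set (\<lambda>j. w B j / box_volume B - F j) {..<s})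
        \<in> O[width_to_infinity](\<lambda>B. box_width B powr (-\<delta>))"
    proof (rule bigoI[of _ "\<Sum>j<s. A j"], rule eventually_mono[OF ev])
      fix B assume B: "\<forall>j\<in>{..<s}.
        \<bar>w B j / box_volume B - f j\<bar> \<le> A j * box_width B powr (-\<delta>)"
      have "L2_set (\<lambda>j. w B j / box_volume B - F j) {..<s}
          \<le> (\<Sum>j<s. \<bar>w B j / box_volume B - F j\<bar>)"
        by (rule L2_set_le_sum_abs)
      also have "\<dots> \<le> (\<Sum>j<s. A j * box_width B powr (-\<delta>))"
        using B by (intro sum_mono) (simp add: F_def)
      finally show "norm (L2_set (\<lambda>j. w B j / box_volume B - F j) {..<s})
          \<le> (\<Sum>j<s. A j) * norm (box_width B powr (-\<delta>))"
        by (simp add: L2_set_nonneg sum_distrib_right)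
    qed
    moreover have "F \<in> topspace (Euclidean_space s)"
      by (simp add: F_def topspace_Euclidean_space)
    ultimately show ?thesis by blast
  qed
  then show ?thesis using \<delta>(1) by blast
qed

end
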